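(* Let $R=\mathbb R[[t]]\ltimes\mathbb R[[t]]$. Then $$|\mathcal A^*(R)|=\aleph_0\qquad\text{and}\qquad |\mathcal I^*(R)|=2^{\aleph_0}.$$ In particular, $|\mathcal A^*(R)|<|\mathcal I^*(R)|$. Consequently, the assertion "for every commutative ring $S$ with identity which is not a domain, $|\mathcal A^*(S)|=|\mathcal I^*(S)|$" (the Behboodi--Rakeei conjecture) does not hold in general.
   Context: $\mathbb R[[t]]$ is the ring of formal power series in $t$ over the real numbers. For a commutative ring $D$ and a $D$-module $M$, the idealization $D\ltimes M$ is the commutative ring whose additive group is $D\oplus M$ and whose multiplication is $(d,m)(d',m')=(dd',dm'+d'm)$; here $D=\mathbb R[[t]]$ and $M=D$ as a module over itself. For a commutative ring $S$ with identity, $\mathcal I^*(S)$ denotes the set of ideals $I$ of $S$ with $0\neq I\neq S$, and $\mathcal A^*(S)$ denotes the set of those $I\in\mathcal I^*(S)$ with $\operatorname{Ann}_S(I)=\{s\in S:sI=0\}\neq 0$. $|X|$ denotes the cardinality of a set $X$. *)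

theory Defs
  imports "HOL-Algebra.Algebraic_Closure_Type" "HOL-Computational_Algebra.Formal_Power_Series"
begin

unbundle cardinal_syntax

definition self_module :: "('a, 'x) ring_scheme \<Rightarrow> ('a, 'a) module" where
  "self_module D = \<lparr>carrier = carrier D, monoid.mult = monoid.mult D, one = \<one>\<^bsub>D\<^esub>,
     zero = \<zero>\<^bsub>D\<^esub>, add = add D, module.smult = monoid.mult D\<rparr>"

(* The fields mult and one of the module record M carry no meaning in the locale module,
   so they are not used here. *)
definition idealization ::
    "('a, 'x) ring_scheme \<Rightarrow> ('a, 'm, 'y) module_scheme \<Rightarrow> ('a \<times> 'm) ring" where
  "idealization D M = \<lparr>carrier = carrier D \<times> carrier M,
     monoid.mult = (\<lambda>(d, m) (d', m').
       (d \<otimes>\<^bsub>D\<^esub> d', (d \<odot>\<^bsub>M\<^esub> m') \<oplus>\<^bsub>M\<^esub> (d' \<odot>\<^bsub>M\<^esub> m))),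
     one = (\<one>\<^bsub>D\<^esub>, \<zero>\<^bsub>M\<^esub>),
     zero = (\<zero>\<^bsub>D\<^esub>, \<zero>\<^bsub>M\<^esub>),
     add = (\<lambda>(d, m) (d', m'). (d \<oplus>\<^bsub>D\<^esub> d', m \<oplus>\<^bsub>M\<^esub> m'))\<rparr>"

definition annihilator :: "('a, 'x) ring_scheme \<Rightarrow> 'a set \<Rightarrow> 'a set" where
  "annihilator S I = {s \<in> carrier S. \<forall>a\<in>I. s \<otimes>\<^bsub>S\<^esub> a = \<zero>\<^bsub>S\<^esub>}"

definition nontrivial_ideals :: "('a, 'x) ring_scheme \<Rightarrow> 'a set set" (\<open>\<I>\<^sup>*\<close>) where
  "\<I>\<^sup>* S = {I. ideal I S \<and> I \<noteq> {\<zero>\<^bsub>S\<^esub>} \<and> I \<noteq> carrier S}"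

definition annihilating_ideals :: "('a, 'x) ring_scheme \<Rightarrow> 'a set set" (\<open>\<A>\<^sup>*\<close>) where
  "\<A>\<^sup>* S = {I \<in> \<I>\<^sup>* S. annihilator S I \<noteq> {\<zero>\<^bsub>S\<^esub>}}"

lemma module_self_module:
  assumes "cring D"
  shows "module D (self_module D)"
proof -
  interpret cring D by fact
  show ?thesis
  proof (rule moduleI)
    show "abelian_group (self_module D)"
    proof (rule abelian_groupI)
      fix x assume "x \<in> carrier (self_module D)"
      then show "\<exists>y\<in>carrier (self_module D). y \<oplus>\<^bsub>self_module D\<^esub> x = \<zero>\<^bsub>self_module D\<^esub>"
        by (intro bexI[of _ "\<ominus>\<^bsub>D\<^esub> x"]) (auto simp: self_module_def l_neg)
    qed (auto simp: self_module_def a_ac)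
    show "cring D" by fact
  qed (auto simp: self_module_def l_distr r_distr m_assoc)
qed

lemma cring_idealization:
  assumes "module D M"
  shows "cring (idealization D M)"
proof -
  interpret module D M by fact
  note simps = idealization_def smult_l_distr smult_r_distr
    R.l_distr smult_l_null smult_r_null
  show ?thesis
  proof (rule cringI)
    show "abelian_group (idealization D M)"
    proof (rule abelian_groupI)
      fix x assume "x \<in> carrier (idealization D M)"
      then show "\<exists>y\<in>carrier (idealization D M). y \<oplus>\<^bsub>idealization D M\<^esub> x = \<zero>\<^bsub>idealization D M\<^esub>"
        by (intro bexI[of _ "(\<ominus>\<^bsub>D\<^esub> fst x, \<ominus>\<^bsub>M\<^esub> snd x)"])
          (auto simp: simps R.l_neg M.l_neg)
    qed (auto simp: simps R.a_ac M.a_ac)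
    show "comm_monoid (idealization D M)"
    proof (rule comm_monoidI)
      fix x y z
      assume "x \<in> carrier (idealization D M)" "y \<in> carrier (idealization D M)" "z \<in> carrier (idealization D M)"
      then show "x \<otimes>\<^bsub>idealization D M\<^esub> y \<otimes>\<^bsub>idealization D M\<^esub> z
          = x \<otimes>\<^bsub>idealization D M\<^esub> (y \<otimes>\<^bsub>idealization D M\<^esub> z)"
        by (auto simp: simps smult_assoc1[symmetric] R.m_ac M.a_ac)
    qed (auto simp: simps R.m_comm M.a_comm)
  qed (auto simp: simps M.a_ac R.a_ac)
qed

end

theory Submission
  imports Defs "HOL-Analysis.Abstract_Topology_2"
begin

text \<open>
  Over \<open>D = k[[t]]\<close>, the annihilator of a nonzero ideal \<open>I\<close> of \<open>D \<ltimes> D\<close> can only be nonzero if \<open>I\<close>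
  lies in the square-zero part \<open>0 \<times> D\<close>; hence the annihilating ideals are exactly the ideals
  \<open>0 \<times> t\<^sup>n D\<close>. On the other hand, the principal ideals generated by \<open>(t, c)\<close> for scalars \<open>c \<in> k\<close> are
  pairwise distinct, which gives at least \<open>|k|\<close> ideals. Conversely every ideal is determined by
  three power series: a pair \<open>(d, m) \<in> I\<close> with \<open>d\<close> generating the first projection of \<open>I\<close>, and a
  generator \<open>q\<close> of \<open>{y. (0, y) \<in> I}\<close>. For \<open>k = \<real>\<close> both bounds equal the continuum.
\<close>

section \<open>The self-idealization of a commutative ring, in coordinates\<close>

abbreviation self_idealization :: "('a::comm_ring_1 \<times> 'a) ring" where
  "self_idealization \<equiv> idealization ring_of_type_algebra (self_module ring_of_type_algebra)"

lemma self_idealization_simps: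
  "carrier (self_idealization :: ('a::comm_ring_1 \<times> 'a) ring) = UNIV"
  "\<zero>\<^bsub>self_idealization :: ('a \<times> 'a) ring\<^esub> = (0, 0)"
  "\<one>\<^bsub>self_idealization :: ('a \<times> 'a) ring\<^esub> = (1, 0)"
  "(a, b) \<oplus>\<^bsub>self_idealization :: ('a \<times> 'a) ring\<^esub> (x, y) = (a + x, b + y)"
  "(a, b) \<otimes>\<^bsub>self_idealization :: ('a \<times> 'a) ring\<^esub> (x, y) = (a * x, a * y + x * b)"
  by (simp_all add: idealization_def self_module_def ring_of_type_algebra_def)

lemma cring_self_idealization: "cring (self_idealization :: ('a::comm_ring_1 \<times> 'a) ring)"
  by (intro cring_idealization module_self_module cring_from_type_algebra)

lemma not_domain_self_idealization: "\<not> domain (self_idealization :: ('a::comm_ring_1 \<times> 'a) ring)"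
proof
  assume "domain (self_idealization :: ('a \<times> 'a) ring)"
  then interpret domain "self_idealization :: ('a \<times> 'a) ring" .
  \<comment> \<open>\<open>(0, 1)\<close> is nonzero with square zero.\<close>
  show False
    using integral[of "(0, 1)" "(0, 1)"] by (simp add: self_idealization_simps)
qed

text \<open>The last clause is multiplication by \<open>(r, s)\<close> written out. Taking
  \<open>(- 1, 0)\<close> there yields negatives, so closure under negation is not listed
  separately.\<close>

lemma ideal_self_idealization_iff:
  fixes I :: "('a::comm_ring_1 \<times> 'a) set"
  shows "ideal I self_idealization \<longleftrightarrow> (0, 0) \<in> I
    \<and> (\<forall>x y x' y'. (x, y) \<in> I \<longrightarrow> (x', y') \<in> I \<longrightarrow> (x + x', y + y') \<in> I)
    \<and> (\<forall>x y r s. (x, y) \<in> I \<longrightarrow> (r * x, r * y + s * x) \<in> I)"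
    (is "?L \<longleftrightarrow> ?R")
proof
  interpret R: cring "self_idealization :: ('a \<times> 'a) ring"
    by (rule cring_self_idealization)
  {
    assume ?L
    then interpret ideal I self_idealization .
    show ?R
    proof (intro conjI allI impI)
      show "(0, 0) \<in> I"
        using zero_closed by (simp add: self_idealization_simps)
      show "(x + x', y + y') \<in> I" if "(x, y) \<in> I" "(x', y') \<in> I" for x y x' y'
        using a_closed[OF that] by (simp add: self_idealization_simps)
      show "(r * x, r * y + s * x) \<in> I" if "(x, y) \<in> I" for x y r s
        using I_l_closed[OF that, of "(r, s)"] by (simp add: self_idealization_simps mult.commute)
    qed
  next
    assume R: ?R
    have neg: "\<exists>z\<in>I. z \<oplus>\<^bsub>self_idealization\<^esub> p = \<zero>\<^bsub>self_idealization\<^esub>" if "p \<in> I" for p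
    proof -
      obtain x y where p: "p = (x, y)" by (cases p)
      with that R have "(- 1 * x, - 1 * y + 0 * x) \<in> I" by blast
      then show ?thesis
        by (intro bexI[of _ "(- x, - y)"]) (simp_all add: p self_idealization_simps)
    qed
    have inv: "\<ominus>\<^bsub>self_idealization\<^esub> p \<in> I" if "p \<in> I" for p
      using neg[OF that] R.minus_equality by (metis UNIV_I self_idealization_simps(1))
    have mult: "r \<otimes>\<^bsub>self_idealization\<^esub> p \<in> I" if "p \<in> I" for p r
      using R that by (cases p; cases r) (simp add: self_idealization_simps mult.commute)
    show ?L
    proof (rule idealI)
      show "ring (self_idealization :: ('a \<times> 'a) ring)"
        by (rule R.ring_axioms)
      show "subgroup I (add_monoid self_idealization)"
      proof (rule R.add.subgroupI)
        show "I \<noteq> {}" using R by blast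
        show "p \<oplus>\<^bsub>self_idealization\<^esub> p' \<in> I" if "p \<in> I" "p' \<in> I" for p p'
          using R that by (cases p; cases p') (simp add: self_idealization_simps)
      qed (simp_all add: inv self_idealization_simps)
      show "r \<otimes>\<^bsub>self_idealization\<^esub> p \<in> I" if "p \<in> I" for p r
        by (rule mult[OF that])
      show "p \<otimes>\<^bsub>self_idealization\<^esub> r \<in> I" if "p \<in> I" for p r
        using mult[OF that, of r] R.m_comm[of r p] by (simp add: self_idealization_simps)
    qed
  }
qed

section \<open>Ideals over power series over a field\<close>

lemma fps_set_has_gcd_element:
  fixes J :: "'a::field fps set"
  assumes "J \<noteq> {}"
  shows "\<exists>d\<in>J. \<forall>x\<in>J. d dvd x"
proof (cases "J \<subseteq> {0}")
  case True
  with assms show ?thesis by (intro bexI[of _ 0]) auto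
next
  case False
  \<comment> \<open>Divisibility between nonzero power series compares subdegrees, so a nonzero
    element of least subdegree divides the whole set.\<close>
  then obtain d where "d \<in> J - {0}" and min: "\<And>x. x \<in> J - {0} \<Longrightarrow> subdegree d \<le> subdegree x"
    using ex_has_least_nat[of "\<lambda>x. x \<in> J - {0}" _ subdegree] by auto
  show ?thesis
  proof (intro bexI ballI)
    show "d \<in> J" using \<open>d \<in> J - {0}\<close> by simp
    show "d dvd x" if "x \<in> J" for x
      using \<open>d \<in> J - {0}\<close> that min[of x] by (cases "x = 0") (auto simp: fps_dvd_iff)
  qed
qed

text \<open>Subtracting a suitable multiple of a chosen pair \<open>(d, m)\<close> in
  \<open>I\<close> clears the first coordinate, and what remains lies in the slice over 0, where
  every element is a multiple of \<open>q\<close>.\<close>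

lemma ideal_self_idealization_fps_form:
  fixes I :: "('a::field fps \<times> 'a fps) set"
  assumes "ideal I self_idealization"
  obtains d m q where "I = {(d * e, e * m + q * f) | e f. True}"
proof -
  have zero: "(0, 0) \<in> I"
    and add: "\<And>x y x' y'. (x, y) \<in> I \<Longrightarrow> (x', y') \<in> I \<Longrightarrow> (x + x', y + y') \<in> I"
    and mult: "\<And>x y r. (x, y) \<in> I \<Longrightarrow> (r * x, r * y) \<in> I"
    using assms unfolding ideal_self_idealization_iff
    by (blast, blast, metis add.right_neutral mult_zero_left)
  obtain d where "d \<in> fst ` I" and d: "\<forall>x\<in>fst ` I. d dvd x"
    using fps_set_has_gcd_element[of "fst ` I"] zero by blast
  then obtain m where m: "(d, m) \<in> I" by auto
  obtain q where q: "(0, q) \<in> I" "\<And>y. (0, y) \<in> I \<Longrightarrow> q dvd y"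
    using fps_set_has_gcd_element[of "{y. (0, y) \<in> I}"] zero by (metis empty_iff mem_Collect_eq)
  have "\<exists>e f. x = d * e \<and> y = e * m + q * f" if xy: "(x, y) \<in> I" for x y
  proof -
    obtain e where e: "x = d * e"
      using d xy by (metis dvdE fst_conv image_eqI)
    \<comment> \<open>Since \<open>x = d * e\<close>, the first coordinate here is 0.\<close>
    have "(x + (- e) * d, y + (- e) * m) \<in> I"
      using xy mult[OF m] by (rule add)
    then have "q dvd y - e * m"
      by (intro q) (simp add: e mult.commute)
    then obtain f where "y - e * m = q * f" ..
    then show ?thesis using e by (metis add.commute diff_add_cancel)
  qed
  moreover have "(d * e, e * m + q * f) \<in> I" for e f
    using add[OF mult[OF m, of e] mult[OF q(1), of f]] by (simp add: mult.commute)
  ultimately show ?thesis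
    by (intro that[of d m q]) auto
qed

section \<open>Classification and count of the annihilating ideals\<close>

lemma annihilating_ideals_self_idealization_fps:
  "\<A>\<^sup>* (self_idealization :: ('a::field fps \<times> 'a fps) ring)
     = range (\<lambda>n. {0} \<times> {y. fps_X ^ n dvd y})" (is "_ = range ?N")
proof (intro equalityI subsetI)
  fix I :: "('a fps \<times> 'a fps) set"
  assume "I \<in> \<A>\<^sup>* self_idealization"
  then have I: "ideal I self_idealization" "I \<noteq> {(0, 0)}"
    and ann: "annihilator self_idealization I \<noteq> {(0, 0)}"
    by (auto simp: annihilating_ideals_def nontrivial_ideals_def self_idealization_simps)
  have zero: "(0, 0) \<in> I"
    and mult: "\<And>x y r. (x, y) \<in> I \<Longrightarrow> (r * x, r * y) \<in> I"
    using I(1) unfolding ideal_self_idealization_iff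
    by (blast, metis add.right_neutral mult_zero_left)
  have "(0, 0) \<in> annihilator self_idealization I"
    by (auto simp: annihilator_def self_idealization_simps)
  with ann obtain a b where "(a, b) \<in> annihilator self_idealization I" and ab: "(a, b) \<noteq> (0, 0)"
    by force
  then have *: "a * x = 0 \<and> a * y + x * b = 0" if "(x, y) \<in> I" for x y
    using that by (fastforce simp: annihilator_def self_idealization_simps(2,5))
  obtain x\<^sub>0 y\<^sub>0 where nz: "(x\<^sub>0, y\<^sub>0) \<in> I" "(x\<^sub>0, y\<^sub>0) \<noteq> (0, 0)"
    using zero I(2) by force
  \<comment> \<open>Power series over a field form a domain: if \<open>a\<close> were nonzero,
    \<open>a * x\<^sub>0 = 0\<close> would give \<open>x\<^sub>0 = 0\<close>, and then the second
    equation \<open>y\<^sub>0 = 0\<close>.\<close>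
  have "a = 0"
    using *[OF nz(1)] nz(2) by auto
  then have "b \<noteq> 0"
    using ab by simp
  \<comment> \<open>With \<open>a = 0\<close> the second equation reads \<open>x * b = 0\<close>,
    which forces \<open>I\<close> into the square-zero part.\<close>
  have fst0: "x = 0" if "(x, y) \<in> I" for x y
    using *[OF that] \<open>a = 0\<close> \<open>b \<noteq> 0\<close> by simp
  obtain q where q: "(0, q) \<in> I" "\<And>y. (0, y) \<in> I \<Longrightarrow> q dvd y"
    using fps_set_has_gcd_element[of "{y. (0, y) \<in> I}"] zero by (metis empty_iff mem_Collect_eq)
  have "q \<noteq> 0"
    using fst0[OF nz(1)] nz q(2)[of y\<^sub>0] by auto
  \<comment> \<open>A nonzero \<open>q\<close> is a unit times
    \<open>fps_X ^ subdegree q\<close>.\<close>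
  then have "q dvd y \<longleftrightarrow> fps_X ^ subdegree q dvd y" for y
    by (cases "y = 0") (simp_all add: fps_dvd_iff fps_X_power_subdegree)
  moreover have "(0, y) \<in> I" if "q dvd y" for y
    using that mult[OF q(1)] by (auto elim!: dvdE simp: mult.commute)
  moreover have "q dvd y" if "(x, y) \<in> I" for x y
    using fst0[OF that] that q(2) by simp
  ultimately have "I = ?N (subdegree q)"
    using fst0 by auto
  then show "I \<in> range ?N" by blast
next
  fix I :: "('a fps \<times> 'a fps) set"
  assume "I \<in> range ?N"
  then obtain n where I: "I = ?N n" by blast
  have "ideal I self_idealization"
    unfolding ideal_self_idealization_iff I by (simp add: dvd_add dvd_mult)
  \<comment> \<open>These two pairs witness that \<open>I\<close> is nonzero and proper, also for
    \<open>n = 0\<close>, where \<open>I\<close> is the whole square-zero part.\<close>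
  moreover have "(0, fps_X ^ n) \<in> I" "(1, 0) \<notin> I"
    by (simp_all add: I)
  then have "I \<noteq> {(0, 0)}" "I \<noteq> UNIV"
    by (force, blast)
  \<comment> \<open>Products of two elements with first coordinate 0 vanish.\<close>
  moreover have "(0, 1) \<in> annihilator self_idealization I"
    by (auto simp: I annihilator_def self_idealization_simps)
  then have "annihilator self_idealization I \<noteq> {(0, 0)}"
    by force
  ultimately show "I \<in> \<A>\<^sup>* self_idealization"
    by (simp add: annihilating_ideals_def nontrivial_ideals_def self_idealization_simps)
qed

lemma card_annihilating_ideals_self_idealization_fps:
  "|\<A>\<^sup>* (self_idealization :: ('a::field fps \<times> 'a fps) ring)| =o natLeq"
proof -
  have "inj (\<lambda>n. {0 :: 'a fps} \<times> {y :: 'a fps. fps_X ^ n dvd y})"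
  proof (rule injI)
    fix i j :: nat
    assume eq: "{0 :: 'a fps} \<times> {y :: 'a fps. fps_X ^ i dvd y} = {0} \<times> {y. fps_X ^ j dvd y}"
    \<comment> \<open>Each ideal contains its own generator, so equal ideals give powers that divide
      each other.\<close>
    have "(0, fps_X ^ i) \<in> {0 :: 'a fps} \<times> {y :: 'a fps. fps_X ^ i dvd y}"
      and "(0, fps_X ^ j) \<in> {0 :: 'a fps} \<times> {y :: 'a fps. fps_X ^ j dvd y}"
      by simp_all
    then have "(fps_X ^ j :: 'a fps) dvd fps_X ^ i" "(fps_X ^ i :: 'a fps) dvd fps_X ^ j"
      by (metis eq SigmaD2 mem_Collect_eq)+
    then show "i = j"
      by (simp add: fps_dvd_iff fps_X_power_subdegree)
  qed
  then have "|UNIV :: nat set| =o |\<A>\<^sup>* (self_idealization :: ('a fps \<times> 'a fps) ring)|"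
    unfolding annihilating_ideals_self_idealization_fps
    by (intro card_of_ordIsoI[OF inj_on_imp_bij_betw])
  then show ?thesis
    using card_of_nat ordIso_symmetric ordIso_transitive by blast
qed

section \<open>Lower and upper bounds on the number of nontrivial ideals\<close>

lemma scalars_ordLeq_nontrivial_ideals_self_idealization_fps:
  "|UNIV :: 'a set| \<le>o |\<I>\<^sup>* (self_idealization :: ('a::field fps \<times> 'a fps) ring)|"
proof -
  \<comment> \<open>\<open>P c\<close> is the principal ideal of
    \<open>(fps_X, fps_const c)\<close>: the listed pair is this generator times
    \<open>(e, f)\<close>.\<close>
  define P :: "'a \<Rightarrow> ('a fps \<times> 'a fps) set" where
    "P c = {(fps_X * e, fps_X * f + fps_const c * e) | e f. True}" for c
  have gen: "(fps_X, fps_const c) \<in> P c" for c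
    unfolding P_def by (intro CollectI exI[of _ 1] exI[of _ 0]) simp
  have "inj P"
  proof (rule injI)
    fix b c assume "P b = P c"
    then have "(fps_X, fps_const b) \<in> P c"
      using gen by metis
    then obtain e f :: "'a fps"
      where *: "fps_X = fps_X * e" "fps_const b = fps_X * f + fps_const c * e"
      unfolding P_def by auto
    \<comment> \<open>Cancel \<open>fps_X\<close>. In the second equation the term
      \<open>fps_X * f\<close> has constant coefficient 0, so comparing constant coefficients leaves
      \<open>b = c\<close>.\<close>
    then have "e = 1" by simp
    with arg_cong[OF *(2), of "\<lambda>g. fps_nth g 0"] show "b = c" by simp
  qed
  moreover have "P c \<in> \<I>\<^sup>* self_idealization" for c
  proof -
    have "ideal (P c) self_idealization"
      unfolding ideal_self_idealization_iff
    proof (intro conjI allI impI)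
      show "(0, 0) \<in> P c"
        unfolding P_def by (intro CollectI exI[of _ 0]) simp
      show "(x + x', y + y') \<in> P c" if xy: "(x, y) \<in> P c" "(x', y') \<in> P c" for x y x' y'
      proof -
        obtain e f e' f' where "x = fps_X * e" "y = fps_X * f + fps_const c * e"
          "x' = fps_X * e'" "y' = fps_X * f' + fps_const c * e'"
          using xy unfolding P_def by auto
        then show ?thesis
          unfolding P_def
          by (intro CollectI exI[of _ "e + e'"] exI[of _ "f + f'"]) (simp add: algebra_simps)
      qed
      show "(r * x, r * y + s * x) \<in> P c" if xy: "(x, y) \<in> P c" for x y r s
      proof -
        obtain e f where "x = fps_X * e" "y = fps_X * f + fps_const c * e"
          using xy unfolding P_def by auto
        then show ?thesis
          unfolding P_def
          by (intro CollectI exI[of _ "r * e"] exI[of _ "r * f + s * e"]) (simp add: algebra_simps)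
      qed
    qed
    moreover have "P c \<noteq> {(0, 0)}"
      using gen[of c] by auto
    \<comment> \<open>First coordinates in \<open>P c\<close> are multiples of \<open>fps_X\<close>,
      which is not a unit.\<close>
    moreover have "(1, 0) \<notin> P c"
    proof
      assume "(1, 0) \<in> P c"
      then obtain e :: "'a fps" where "1 = fps_X * e"
        unfolding P_def by auto
      from arg_cong[OF this, of "\<lambda>g. fps_nth g 0"] show False by simp
    qed
    then have "P c \<noteq> UNIV" by blast
    ultimately show ?thesis
      by (simp add: nontrivial_ideals_def self_idealization_simps)
  qed
  ultimately show ?thesis
    by (intro card_of_ordLeqI[of P]) auto
qed

text \<open>The normal form writes each ideal as the image of a triple \<open>(d, m, q)\<close>. An
  arbitrary triple need not give an ideal, which is harmless for an upper bound.\<close>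

lemma nontrivial_ideals_self_idealization_fps_ordLeq:
  "|\<I>\<^sup>* (self_idealization :: ('a::field fps \<times> 'a fps) ring)|
     \<le>o |UNIV :: ('a fps \<times> 'a fps \<times> 'a fps) set|"
proof -
  have "\<I>\<^sup>* (self_idealization :: ('a fps \<times> 'a fps) ring)
      \<subseteq> range (\<lambda>(d, m, q). {(d * e, e * m + q * f) | e f. True})"
  proof
    fix I :: "('a fps \<times> 'a fps) set"
    assume "I \<in> \<I>\<^sup>* self_idealization"
    then have "ideal I self_idealization"
      by (simp add: nontrivial_ideals_def)
    then obtain d m q where "I = {(d * e, e * m + q * f) | e f. True}"
      by (rule ideal_self_idealization_fps_form)
    then show "I \<in> range (\<lambda>(d, m, q). {(d * e, e * m + q * f) | e f. True})"
      by (intro image_eqI[of _ _ "(d, m, q)"]) simp_all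
  qed
  then show ?thesis
    by (rule surj_imp_ordLeq)
qed

section \<open>Cardinal arithmetic of the continuum and the conclusion\<close>

lemma card_real: "|UNIV :: real set| =o ctwo ^c natLeq"
proof -
  have "|UNIV :: real set| =o |UNIV :: nat set set|"
    using nat_sets_eqpoll_reals eqpoll_iff_card_of_ordIso ordIso_symmetric by blast
  also have "|UNIV :: nat set set| =o ctwo ^c natLeq"
    using card_of_Pow_Func[of "UNIV :: nat set"]
    by (simp add: cexp_def ctwo_def Field_card_of Field_natLeq)
  finally (ordIso_transitive) show ?thesis .
qed

text \<open>A power series is its coefficient sequence, a function on the naturals.\<close>

lemma card_fps: "|UNIV :: 'a::zero fps set| =o |UNIV :: 'a set| ^c natLeq"
proof -
  have "bij (fps_nth :: 'a fps \<Rightarrow> _)"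
    by (rule bij_betw_byWitness[where f' = Abs_fps]) (auto simp: fps_nth_inverse)
  then have "|UNIV :: 'a fps set| =o |UNIV :: (nat \<Rightarrow> 'a) set|"
    by (rule card_of_ordIsoI)
  then show ?thesis
    by (simp add: cexp_def Field_card_of Field_natLeq Func_def)
qed

text \<open>Currying turns the iterated power into the exponent \<open>natLeq *c natLeq\<close>,
  which is again \<open>natLeq\<close>.\<close>

lemma card_real_fps: "|UNIV :: real fps set| =o ctwo ^c natLeq"
proof -
  have "|UNIV :: real fps set| =o |UNIV :: real set| ^c natLeq"
    by (rule card_fps)
  also have "|UNIV :: real set| ^c natLeq =o (ctwo ^c natLeq) ^c natLeq"
    by (intro cexp_cong1 card_real natLeq_Card_order)
  also have "(ctwo ^c natLeq) ^c natLeq =o ctwo ^c (natLeq *c natLeq)"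
    by (intro cexp_cprod Card_order_ctwo)
  also have "ctwo ^c (natLeq *c natLeq) =o ctwo ^c natLeq"
    by (intro cexp_cong2 cprod_infinite natLeq_Cinfinite Card_order_ctwo natLeq_Card_order
        Card_order_cprod)
  finally (ordIso_transitive) show ?thesis .
qed

lemma card_nontrivial_ideals_self_idealization_real_fps:
  "|\<I>\<^sup>* (self_idealization :: (real fps \<times> real fps) ring)| =o ctwo ^c natLeq"
proof -
  have inf: "Cinfinite (ctwo ^c natLeq)"
    by (intro Cinfinite_cexp natLeq_Cinfinite ordLeq_refl Card_order_ctwo)
  have le: "|UNIV :: real fps set| \<le>o ctwo ^c natLeq"
    by (intro ordIso_imp_ordLeq card_real_fps)
  \<comment> \<open>An infinite cardinal absorbs binary products; used twice, this bounds the
    triples.\<close>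
  have "|UNIV \<times> UNIV :: (real fps \<times> real fps) set| \<le>o ctwo ^c natLeq"
    using inf le by (intro card_of_Times_ordLeq_infinite_Field) (auto simp: cinfinite_def)
  then have "|UNIV \<times> (UNIV \<times> UNIV) :: (real fps \<times> real fps \<times> real fps) set| \<le>o ctwo ^c natLeq"
    using inf le by (intro card_of_Times_ordLeq_infinite_Field) (auto simp: cinfinite_def)
  then have "|\<I>\<^sup>* (self_idealization :: (real fps \<times> real fps) ring)| \<le>o ctwo ^c natLeq"
    using nontrivial_ideals_self_idealization_fps_ordLeq ordLeq_transitive by fastforce
  \<comment> \<open>The scalars here are the reals, already continuum many.\<close>
  moreover have "ctwo ^c natLeq \<le>o |\<I>\<^sup>* (self_idealization :: (real fps \<times> real fps) ring)|"
    using card_real scalars_ordLeq_nontrivial_ideals_self_idealization_fps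
      ordIso_symmetric ordIso_ordLeq_trans by blast
  ultimately show ?thesis
    by (simp add: ordIso_iff_ordLeq)
qed

theorem theorem3p3:
  fixes R :: "(real fps \<times> real fps) ring"
  assumes "R = idealization (ring_of_type_algebra :: real fps ring) (self_module ring_of_type_algebra)"
  shows "( |\<A>\<^sup>* R| =o natLeq \<and> |\<I>\<^sup>* R| =o ctwo ^c natLeq) \<and>
    |\<A>\<^sup>* R| <o |\<I>\<^sup>* R| \<and>
    \<not> (\<forall>S :: (real fps \<times> real fps) ring.
         cring S \<and> \<not> domain S \<longrightarrow> |\<A>\<^sup>* S| =o |\<I>\<^sup>* S| )"
proof -
  have A: "|\<A>\<^sup>* R| =o natLeq"
    unfolding assms by (rule card_annihilating_ideals_self_idealization_fps)
  have I: "|\<I>\<^sup>* R| =o ctwo ^c natLeq"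
    unfolding assms by (rule card_nontrivial_ideals_self_idealization_real_fps)
  \<comment> \<open>Cantor's theorem.\<close>
  have "natLeq <o ctwo ^c natLeq"
    by (intro ordLess_ctwo_cexp natLeq_Card_order)
  with A I have less: "|\<A>\<^sup>* R| <o |\<I>\<^sup>* R|"
    using ordIso_ordLess_trans ordLess_ordIso_trans ordIso_symmetric by blast
  \<comment> \<open>\<open>R\<close> itself is the counterexample \<open>S\<close>.\<close>
  moreover have "cring R" "\<not> domain R"
    unfolding assms by (rule cring_self_idealization not_domain_self_idealization)+
  ultimately show ?thesis
    using A I not_ordLess_ordIso by blast
qed

end
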